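(* For each $N>0$, the symmetric representation $\overline{H}_N$ of the $N$-th Sylvester-Hadamard matrix (that is, the symmetric representation of $H=\begin{pmatrix}1&1\\1&-1\end{pmatrix}$ in degree $N$) equals the transposed $N$-th Krawtchouk matrix: $$(\overline{H}_N)_{ij}=K^{(N)}_{ji}\qquad\text{for all }0\le i,j\le N.$$
   Context: The $N$-th order Krawtchouk matrix $K^{(N)}$ is the $(N+1)\times(N+1)$ matrix, with indices running from $0$ to $N$, determined by $(1+v)^{N-j}(1-v)^j=\sum_{i=0}^N v^i K^{(N)}_{ij}$. The $N$-th Sylvester-Hadamard matrix is the Kronecker power $H^{\otimes N}$. For a linear map $A$ on a $d$-dimensional real vector space $V$, the operator $A_N=A^{\otimes N}$ on $V^{\otimes N}$ induces an operator $\overline{A}_N$ on the $N$-th symmetric tensor space, which is identified with the space of homogeneous polynomials of degree $N$ in variables $x_0,\dots,x_{d-1}$ (basis vectors $e_i\mapsto x_i$, tensor products $\mapsto$ products of variables). The operator $\overline{A}_N$ is called the symmetric representation of $A$ in degree $N$. Its matrix elements are defined as follows: if $A$ has entries $A_{ij}$ ($0\le i,j\le d-1$) and $y_i=\sum_j A_{ij}x_j$, then $$y_0^{m_0}\cdots y_{d-1}^{m_{d-1}}=\sum_n \overline{A}_{mn}\,x_0^{n_0}\cdots x_{d-1}^{n_{d-1}},$$ with multi-indices $m,n$ of total degree $N$. For $d=2$, with variables $x=x_0$, $y=x_1$, the basis monomials are $x^{N-k}y^k$ and are indexed by $k$, $0\le k\le N$; thus $(\overline{A}_N)_{kl}$ is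 the coefficient of $x^{N-l}y^l$ in $y_0^{N-k}y_1^{k}$. *)

theory Defs
  imports
    "Jordan_Normal_Form.Matrix"
    "HOL-Library.Poly_Mapping"
    "HOL-Computational_Algebra.Polynomial"
begin

definition krawtchouk :: "nat \<Rightarrow> real mat" where
  "krawtchouk N =
     mat (N + 1) (N + 1) (\<lambda>(i, j). coeff ([:1, 1:] ^ (N - j) * [:1, -1:] ^ j) i)"

lemma krawtchouk_generating:
  assumes "j \<le> N"
  shows "[:1, 1:] ^ (N - j) * [:1, -1:] ^ j = (\<Sum>i\<le>N. monom (krawtchouk N $$ (i, j)) i)"
proof -
  let ?p = "[:1, 1:] ^ (N - j) * [:1, -1:] ^ j :: real poly"
  have 1: "degree ([:1, 1:] ^ (N - j) :: real poly) \<le> N - j"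
    using degree_power_le[of "[:1, 1:] :: real poly" "N - j"] by simp
  have 2: "degree ([:1, -1:] ^ j :: real poly) \<le> j"
    using degree_power_le[of "[:1, -1:] :: real poly" j] by simp
  have "degree ?p \<le> N"
    using degree_mult_le[of "[:1, 1:] ^ (N - j) :: real poly" "[:1, -1:] ^ j"] 1 2 assms by linarith
  then have "?p = (\<Sum>i\<le>N. monom (coeff ?p i) i)"
    by (simp add: poly_as_sum_of_monoms')
  also have "\<dots> = (\<Sum>i\<le>N. monom (krawtchouk N $$ (i, j)) i)"
    using assms by (intro sum.cong) (auto simp: krawtchouk_def)
  finally show ?thesis .
qed

definition hadamard :: "real mat" where
  "hadamard = mat_of_rows_list 2 [[1, 1], [1, -1]]"

text \<open>Real polynomials in the variables \<open>x\<^sub>0, x\<^sub>1, \<dots>\<close>: finitely supported maps from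
  multi-indices (finitely supported exponent vectors) to coefficients, with convolution as product.\<close>

type_synonym mindex = "nat \<Rightarrow>\<^sub>0 nat"
type_synonym mpoly = "mindex \<Rightarrow>\<^sub>0 real"

text \<open>\<open>row_form A i\<close> is the linear form \<open>y\<^sub>i = (\<Sum>j. A\<^sub>i\<^sub>j x\<^sub>j)\<close>.\<close>

definition row_form :: "real mat \<Rightarrow> nat \<Rightarrow> mpoly" where
  "row_form A i =
     (\<Sum>j<dim_col A. Poly_Mapping.single (Poly_Mapping.single j 1) (A $$ (i, j)))"

text \<open>For a square matrix \<open>A\<close> of size \<open>d\<close> and multi-indices \<open>m, n\<close> supported in \<open>{..<d}\<close> and of the
  same total degree \<open>N\<close>, this is the \<open>(m, n)\<close> entry of the symmetric representation of \<open>A\<close> in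
  degree \<open>N\<close>: the coefficient of \<open>x\<^sup>n\<close> in \<open>y\<^sup>m\<close>.\<close>

definition sym_rep_entry :: "real mat \<Rightarrow> mindex \<Rightarrow> mindex \<Rightarrow> real" where
  "sym_rep_entry A m n =
     Poly_Mapping.lookup (\<Prod>i<dim_row A. row_form A i ^ Poly_Mapping.lookup m i) n"

text \<open>The multi-index of \<open>x\<^sub>0\<^sup>N\<^sup>-\<^sup>k x\<^sub>1\<^sup>k\<close>.\<close>

definition mindex2 :: "nat \<Rightarrow> nat \<Rightarrow> mindex" where
  "mindex2 N k = Poly_Mapping.single 0 (N - k) + Poly_Mapping.single 1 k"

text \<open>The symmetric representation in degree \<open>N\<close> of a \<open>2 \<times> 2\<close> matrix.\<close>

definition sym_rep2 :: "nat \<Rightarrow> real mat \<Rightarrow> real mat" where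
  "sym_rep2 N A =
     mat (N + 1) (N + 1) (\<lambda>(k, l). sym_rep_entry A (mindex2 N k) (mindex2 N l))"

definition homog2 :: "nat \<Rightarrow> mpoly \<Rightarrow> bool" where
  "homog2 N p \<longleftrightarrow> Poly_Mapping.keys p \<subseteq> mindex2 N ` {..N}"

lemma homog2_mult:
  assumes "homog2 M p" "homog2 N q"
  shows "homog2 (M + N) (p * q)"
proof -
  have "mindex2 M k + mindex2 N l = mindex2 (M + N) (k + l)" if "k \<le> M" "l \<le> N" for k l
  proof -
    have "M + N - (k + l) = (M - k) + (N - l)" using that by linarith
    then show ?thesis by (simp add: mindex2_def single_add ac_simps)
  qed
  then have add: "mindex2 M k + mindex2 N l \<in> mindex2 (M + N) ` {..M + N}"
    if "k \<le> M" "l \<le> N" for k l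
    using that by (intro image_eqI[of _ _ "k + l"]) auto
  show ?thesis
    unfolding homog2_def
  proof
    fix n assume "n \<in> Poly_Mapping.keys (p * q)"
    then obtain a b where ab: "n = a + b" "a \<in> Poly_Mapping.keys p" "b \<in> Poly_Mapping.keys q"
      using keys_mult[of p q] by blast
    obtain k where "k \<le> M" "a = mindex2 M k"
      using assms(1) ab(2) by (auto simp: homog2_def)
    moreover obtain l where "l \<le> N" "b = mindex2 N l"
      using assms(2) ab(3) by (auto simp: homog2_def)
    ultimately show "n \<in> mindex2 (M + N) ` {..M + N}"
      using ab(1) add by simp
  qed
qed

lemma homog2_power: "homog2 M p \<Longrightarrow> homog2 (M * e) (p ^ e)"
proof (induction e)
  case 0
  show ?case by (auto simp: homog2_def mindex2_def)
next
  case (Suc e)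
  then show ?case using homog2_mult[of M p "M * e" "p ^ e"] by simp
qed

lemma homog2_row_form:
  assumes "dim_col A = 2"
  shows "homog2 1 (row_form A i)"
proof -
  let ?x = "\<lambda>j. Poly_Mapping.single (mindex2 1 j) (A $$ (i, j))"
  have "row_form A i = ?x 0 + ?x 1"
    using assms by (simp add: row_form_def mindex2_def numeral_2_eq_2)
  moreover have "Poly_Mapping.keys (?x j) \<subseteq> mindex2 1 ` {..1}" if "j \<le> 1" for j
    using that by simp
  ultimately show ?thesis
    unfolding homog2_def using keys_add[of "?x 0" "?x 1"] 
    by (smt (verit, best) Un_least order_refl subset_trans zero_le)
qed

lemma inj_mindex2: "inj (mindex2 N)"
  by (rule inj_on_inverseI[where g = "\<lambda>m. Poly_Mapping.lookup m 1"])
    (simp add: mindex2_def lookup_add lookup_single)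

lemma sym_rep2_generating:
  assumes "A \<in> carrier_mat 2 2" "k \<le> N"
  shows "row_form A 0 ^ (N - k) * row_form A 1 ^ k =
    (\<Sum>l\<le>N. Poly_Mapping.single (mindex2 N l) (sym_rep2 N A $$ (k, l)))"
proof -
  let ?p = "row_form A 0 ^ (N - k) * row_form A 1 ^ k"
  have "homog2 (1 * (N - k) + 1 * k) ?p"
    using assms by (intro homog2_mult homog2_power homog2_row_form) auto
  then have hom: "homog2 N ?p" using assms by simp
  have entry: "sym_rep2 N A $$ (k, l) = Poly_Mapping.lookup ?p (mindex2 N l)" if "l \<le> N" for l
    using assms that
    by (simp add: sym_rep2_def sym_rep_entry_def numeral_2_eq_2 mindex2_def lookup_add lookup_single)
  show ?thesis
  proof (rule poly_mapping_eqI)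
    fix n
    have "Poly_Mapping.lookup ?p n =
        (\<Sum>l\<le>N. Poly_Mapping.lookup ?p (mindex2 N l) when mindex2 N l = n)"
    proof (cases "n \<in> mindex2 N ` {..N}")
      case True
      then obtain h where h: "h \<le> N" "n = mindex2 N h" by auto
      have "(\<Sum>l\<le>N. Poly_Mapping.lookup ?p (mindex2 N l) when mindex2 N l = n) =
          (\<Sum>l\<le>N. if l = h then Poly_Mapping.lookup ?p (mindex2 N h) else 0)"
        using h inj_mindex2[of N] by (intro sum.cong) (auto simp: when_def inj_eq)
      then show ?thesis using h by simp
    next
      case False
      then have "Poly_Mapping.lookup ?p n = 0"
        using hom by (auto simp: homog2_def in_keys_iff)
      moreover have "(\<Sum>l\<le>N. Poly_Mapping.lookup ?p (mindex2 N l) when mindex2 N l = n) = 0"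
        using False by (intro sum.neutral) (auto simp: when_def)
      ultimately show ?thesis by simp
    qed
    then show "Poly_Mapping.lookup ?p n = Poly_Mapping.lookup
        (\<Sum>l\<le>N. Poly_Mapping.single (mindex2 N l) (sym_rep2 N A $$ (k, l))) n"
      by (simp add: lookup_sum lookup_single entry)
  qed
qed

end

theory Submission
  imports Defs
begin

text \<open>Homogenization, \<open>p(v) \<mapsto> x\<^sub>0\<^sup>N p(x\<^sub>1 / x\<^sub>0)\<close>, is multiplicative and maps \<open>1 + v\<close>, \<open>1 - v\<close> to the
  linear forms \<open>y\<^sub>0 = x\<^sub>0 + x\<^sub>1\<close>, \<open>y\<^sub>1 = x\<^sub>0 - x\<^sub>1\<close> given by the rows of \<open>H\<close>. So it maps the generating
  function of a column of the Krawtchouk matrix to that of a row of the symmetric representation.\<close>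

definition homogenize :: "nat \<Rightarrow> real poly \<Rightarrow> mpoly" where
  "homogenize N p = (\<Sum>i\<le>N. Poly_Mapping.single (mindex2 N i) (coeff p i))"

text \<open>Injectivity of \<open>mindex2 N\<close> sends distinct powers of v to distinct
  monomials, so no coefficients merge.\<close>

lemma lookup_homogenize:
  assumes "l \<le> N"
  shows "Poly_Mapping.lookup (homogenize N p) (mindex2 N l) = coeff p l"
proof -
  have "Poly_Mapping.lookup (homogenize N p) (mindex2 N l) =
      (\<Sum>i\<le>N. if i = l then coeff p l else 0)"
    unfolding homogenize_def lookup_sum
    by (intro sum.cong) (auto simp: lookup_single when_def inj_eq[OF inj_mindex2])
  then show ?thesis using assms by simp
qed

lemma homogenize_sum: "homogenize N (\<Sum>i\<in>I. f i) = (\<Sum>i\<in>I. homogenize N (f i))"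
proof -
  \<comment> \<open>For infinite \<open>I\<close> both sums are 0 by convention, and
    \<open>Poly_Mapping.single m 0\<close> is 0.\<close>
  have single: "Poly_Mapping.single m (\<Sum>i\<in>I. g i) = (\<Sum>i\<in>I. Poly_Mapping.single m (g i))"
    for m :: mindex and g :: "_ \<Rightarrow> real"
    by (induction I rule: infinite_finite_induct) (auto simp: single_add)
  show ?thesis
    unfolding homogenize_def coeff_sum single by (rule sum.swap)
qed

lemma homogenize_monom:
  assumes "k \<le> N"
  shows "homogenize N (monom a k) = Poly_Mapping.single (mindex2 N k) a"
proof -
  have "homogenize N (monom a k) =
      (\<Sum>i\<le>N. if i = k then Poly_Mapping.single (mindex2 N k) a else 0)"
    unfolding homogenize_def by (intro sum.cong) auto
  then show ?thesis using assms by simp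
qed

text \<open>The bounds keep the truncated subtractions in \<open>mindex2\<close> exact, so the
  exponents of \<open>x\<^sub>0\<close> add too.\<close>

lemma mindex2_add:
  assumes "k \<le> M" "l \<le> N"
  shows "mindex2 M k + mindex2 N l = mindex2 (M + N) (k + l)"
proof -
  have "M + N - (k + l) = (M - k) + (N - l)" using assms by linarith
  then show ?thesis by (simp add: mindex2_def single_add ac_simps)
qed

text \<open>Bilinearity reduces this to monomials, whose exponents add. The degree bounds ensure
  that the sums cut off at \<open>M\<close> and \<open>N\<close> lose no terms.\<close>

lemma homogenize_mult:
  assumes "degree p \<le> M" "degree q \<le> N"
  shows "homogenize (M + N) (p * q) = homogenize M p * homogenize N q"
proof -
  have "p * q = (\<Sum>i\<le>M. monom (coeff p i) i) * (\<Sum>j\<le>N. monom (coeff q j) j)"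
    using assms by (simp add: poly_as_sum_of_monoms')
  also have "\<dots> = (\<Sum>i\<le>M. \<Sum>j\<le>N. monom (coeff p i * coeff q j) (i + j))"
    by (simp add: sum_product mult_monom)
  finally have "homogenize (M + N) (p * q) =
      (\<Sum>i\<le>M. \<Sum>j\<le>N. homogenize (M + N) (monom (coeff p i * coeff q j) (i + j)))"
    by (simp add: homogenize_sum)
  also have "\<dots> = (\<Sum>i\<le>M. \<Sum>j\<le>N. Poly_Mapping.single (mindex2 M i) (coeff p i) *
      Poly_Mapping.single (mindex2 N j) (coeff q j))"
    by (intro sum.cong) (auto simp: homogenize_monom mult_single mindex2_add)
  also have "\<dots> = homogenize M p * homogenize N q"
    by (simp add: homogenize_def sum_product)
  finally show ?thesis .
qed

lemma homogenize_power:
  assumes "degree p \<le> 1"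
  shows "homogenize e (p ^ e) = homogenize 1 p ^ e"
proof (induction e)
  case 0
  show ?case by (simp add: homogenize_def mindex2_def)
next
  case (Suc e)
  have "degree (p ^ e) \<le> e"
    using degree_power_le[of p e] mult_le_mono1[OF assms, of e] by linarith
  then show ?case
    using homogenize_mult[of p 1 "p ^ e" e] assms Suc.IH by simp
qed

lemma row_form_hadamard:
  "row_form hadamard 0 = homogenize 1 [:1, 1:]"
  "row_form hadamard 1 = homogenize 1 [:1, -1:]"
  by (simp_all add: row_form_def homogenize_def hadamard_def mat_of_rows_list_def mindex2_def
      numeral_2_eq_2)

lemma sym_rep_entry_hadamard:
  assumes "k \<le> N" "l \<le> N"
  shows "sym_rep_entry hadamard (mindex2 N k) (mindex2 N l) =
    coeff ([:1, 1:] ^ (N - k) * [:1, -1:] ^ k) l"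
proof -
  have deg: "degree ([:1, 1:] ^ (N - k) :: real poly) \<le> N - k"
      "degree ([:1, -1:] ^ k :: real poly) \<le> k"
    using degree_power_le[of "[:1, 1:] :: real poly" "N - k"]
      degree_power_le[of "[:1, -1:] :: real poly" k] by simp_all
  have "(\<Prod>i<dim_row hadamard. row_form hadamard i ^ Poly_Mapping.lookup (mindex2 N k) i) =
      row_form hadamard 0 ^ (N - k) * row_form hadamard 1 ^ k"
    by (simp add: hadamard_def mat_of_rows_list_def numeral_2_eq_2 mindex2_def lookup_add
        lookup_single)
  also have "\<dots> = homogenize (N - k) ([:1, 1:] ^ (N - k)) * homogenize k ([:1, -1:] ^ k)"
    unfolding row_form_hadamard by (simp add: homogenize_power)
  \<comment> \<open>By \<open>k \<le> N\<close>, the formal degrees \<open>N - k\<close> and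
    \<open>k\<close> add up to \<open>N\<close>.\<close>
  also have "\<dots> = homogenize N ([:1, 1:] ^ (N - k) * [:1, -1:] ^ k)"
    using homogenize_mult[OF deg] assms(1) by simp
  finally show ?thesis
    by (simp add: sym_rep_entry_def lookup_homogenize[OF assms(2)])
qed

theorem proposition3p1:
  fixes N :: nat
  assumes "N > 0"
  shows "sym_rep2 N hadamard = transpose_mat (krawtchouk N)"
  \<comment> \<open>The exponent of 1 - v is the row index of \<open>sym_rep2 N hadamard\<close> but
    the column index of \<open>krawtchouk N\<close>, hence the transpose.\<close>
  by (rule eq_matI) (auto simp: sym_rep2_def krawtchouk_def sym_rep_entry_hadamard)

end
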